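(* Let $(M,J,g)$ be a metallic pseudo-Riemannian manifold such that $J^2=pJ+qI$ with $p,q\in\mathbb{R}$ and $p^2+4q\neq 0$. Let $\nabla$ be the Levi-Civita connection of $g$ and let $D$ be the linear connection on $M$ defined by $$D_XY:=\nabla_XY+\frac{2}{p^2+4q}\,J\big((\nabla_XJ)Y\big)-\frac{p}{p^2+4q}\,(\nabla_XJ)Y$$ for all $X,Y\in C^\infty(TM)$. Then $DJ=0$ and $Dg=0$.
   Context: $M$ is a smooth manifold, $C^\infty(TM)$ denotes its vector fields and $I$ the identity. A metallic pseudo-Riemannian manifold $(M,J,g)$ is a pseudo-Riemannian manifold $(M,g)$ with a $(1,1)$-tensor field $J$ which is $g$-symmetric, i.e. $g(JX,Y)=g(X,JY)$ for all $X,Y\in C^\infty(TM)$, and satisfies $J^2=pJ+qI$ for some real numbers $p,q$. Here $(\nabla_XJ)Y=\nabla_X(JY)-J(\nabla_XY)$, and similarly $(D_XJ)Y=D_X(JY)-J(D_XY)$, $(D_Xg)(Y,Z)=X(g(Y,Z))-g(D_XY,Z)-g(Y,D_XZ)$. *)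

theory Defs
  imports "HOL-Analysis.Analysis" "HOL-Library.Function_Algebras"
begin

text \<open>
  Addition, subtraction, multiplication and zero of functions are pointwise throughout
  (\<^theory>\<open>HOL-Library.Function_Algebras\<close>), so they apply to real functions on a manifold, to
  tangent vectors and to vector fields alike.
\<close>

section \<open>Smooth manifolds\<close>

text \<open>On an open subset of a Euclidean space this is \<open>k\<close>-fold continuous differentiability:
  the directional derivatives in all directions are required to be of class one less.\<close>

primrec Ck_on :: "nat \<Rightarrow> 'e::euclidean_space set \<Rightarrow> ('e \<Rightarrow> 'f::real_normed_vector) \<Rightarrow> bool" where
  "Ck_on 0 S f \<longleftrightarrow> continuous_on S f"
| "Ck_on (Suc k) S f \<longleftrightarrow>
     (\<forall>x\<in>S. f differentiable (at x)) \<and> (\<forall>v. Ck_on k S (\<lambda>x. frechet_derivative f (at x) v))"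

definition smooth_on :: "'e::euclidean_space set \<Rightarrow> ('e \<Rightarrow> 'f::real_normed_vector) \<Rightarrow> bool" where
  "smooth_on S f \<longleftrightarrow> (\<forall>k. Ck_on k S f)"

text \<open>A chart is a pair of its domain and its coordinate map. The points of the manifold are all
  elements of the (Hausdorff, second countable) type \<open>'a\<close>; the atlas need not be maximal.\<close>

type_synonym ('a, 'e) chart = "'a set \<times> ('a \<Rightarrow> 'e)"

definition smooth_manifold ::
  "('a::{t2_space,second_countable_topology}, 'e::euclidean_space) chart set \<Rightarrow> bool" where
  "smooth_manifold \<A> \<longleftrightarrow>
     (\<Union>(U, \<phi>)\<in>\<A>. U) = UNIV \<and>
     (\<forall>(U, \<phi>)\<in>\<A>. open U \<and> open (\<phi> ` U) \<and> homeomorphism U (\<phi> ` U) \<phi> (inv_into U \<phi>)) \<and>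
     (\<forall>(U, \<phi>)\<in>\<A>. \<forall>(V, \<psi>)\<in>\<A>. smooth_on (\<phi> ` (U \<inter> V)) (\<psi> \<circ> inv_into U \<phi>))"

definition smooth_fun :: "('a, 'e::euclidean_space) chart set \<Rightarrow> ('a \<Rightarrow> real) \<Rightarrow> bool" where
  "smooth_fun \<A> f \<longleftrightarrow> (\<forall>(U, \<phi>)\<in>\<A>. smooth_on (\<phi> ` U) (f \<circ> inv_into U \<phi>))"

section \<open>Tangent vectors and vector fields\<close>

text \<open>Tangent vectors at \<open>x\<close> are the derivations at \<open>x\<close> of the algebra of smooth functions. As
  functions in HOL are total, a tangent vector is given the value \<open>0\<close> outside this algebra, so
  that equality of tangent vectors is equality in HOL.\<close>

type_synonym 'a tangent = "('a \<Rightarrow> real) \<Rightarrow> real"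
type_synonym 'a field = "'a \<Rightarrow> 'a tangent"

definition tangent_space :: "('a, 'e::euclidean_space) chart set \<Rightarrow> 'a \<Rightarrow> 'a tangent set" where
  "tangent_space \<A> x = {v.
     (\<forall>f. \<not> smooth_fun \<A> f \<longrightarrow> v f = 0) \<and>
     (\<forall>f h. smooth_fun \<A> f \<longrightarrow> smooth_fun \<A> h \<longrightarrow> v (f + h) = v f + v h) \<and>
     (\<forall>c f. smooth_fun \<A> f \<longrightarrow> v (\<lambda>y. c * f y) = c * v f) \<and>
     (\<forall>f h. smooth_fun \<A> f \<longrightarrow> smooth_fun \<A> h \<longrightarrow> v (f * h) = v f * h x + f x * v h)}"

definition smult_tangent :: "real \<Rightarrow> 'a tangent \<Rightarrow> 'a tangent" (infixr "*\<^sub>T" 75) where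
  "c *\<^sub>T v = (\<lambda>f. c * v f)"

definition smult_field :: "('a \<Rightarrow> real) \<Rightarrow> 'a field \<Rightarrow> 'a field" (infixr "*\<^sub>F" 75) where
  "f *\<^sub>F X = (\<lambda>x. f x *\<^sub>T X x)"

abbreviation const_smult_field :: "real \<Rightarrow> 'a field \<Rightarrow> 'a field" (infixr "*\<^sub>R\<^sub>F" 75) where
  "c *\<^sub>R\<^sub>F X \<equiv> (\<lambda>_. c) *\<^sub>F X"

definition deriv_along :: "'a field \<Rightarrow> ('a \<Rightarrow> real) \<Rightarrow> 'a \<Rightarrow> real" where
  "deriv_along X f = (\<lambda>x. X x f)"

definition vector_fields :: "('a, 'e::euclidean_space) chart set \<Rightarrow> 'a field set" where
  "vector_fields \<A> = {X. (\<forall>x. X x \<in> tangent_space \<A> x) \<and>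
     (\<forall>f. smooth_fun \<A> f \<longrightarrow> smooth_fun \<A> (deriv_along X f))}"

definition lie_bracket :: "'a field \<Rightarrow> 'a field \<Rightarrow> 'a field" where
  "lie_bracket X Y = (\<lambda>x f. X x (deriv_along Y f) - Y x (deriv_along X f))"

section \<open>Tensor fields\<close>

type_synonym 'a tensor11 = "'a \<Rightarrow> 'a tangent \<Rightarrow> 'a tangent"
type_synonym 'a tensor02 = "'a \<Rightarrow> 'a tangent \<Rightarrow> 'a tangent \<Rightarrow> real"

definition app11 :: "'a tensor11 \<Rightarrow> 'a field \<Rightarrow> 'a field" where
  "app11 J X = (\<lambda>x. J x (X x))"

definition app02 :: "'a tensor02 \<Rightarrow> 'a field \<Rightarrow> 'a field \<Rightarrow> 'a \<Rightarrow> real" where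
  "app02 g X Y = (\<lambda>x. g x (X x) (Y x))"

definition tensor_field11 :: "('a, 'e::euclidean_space) chart set \<Rightarrow> 'a tensor11 \<Rightarrow> bool" where
  "tensor_field11 \<A> J \<longleftrightarrow>
     (\<forall>x. \<forall>v\<in>tangent_space \<A> x. J x v \<in> tangent_space \<A> x) \<and>
     (\<forall>x. \<forall>v\<in>tangent_space \<A> x. \<forall>w\<in>tangent_space \<A> x. J x (v + w) = J x v + J x w) \<and>
     (\<forall>x c. \<forall>v\<in>tangent_space \<A> x. J x (c *\<^sub>T v) = c *\<^sub>T J x v) \<and>
     (\<forall>X\<in>vector_fields \<A>. app11 J X \<in> vector_fields \<A>)"

definition tensor_field02 :: "('a, 'e::euclidean_space) chart set \<Rightarrow> 'a tensor02 \<Rightarrow> bool" where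
  "tensor_field02 \<A> g \<longleftrightarrow>
     (\<forall>x. \<forall>u\<in>tangent_space \<A> x. \<forall>v\<in>tangent_space \<A> x. \<forall>w\<in>tangent_space \<A> x.
        g x (u + v) w = g x u w + g x v w \<and> g x w (u + v) = g x w u + g x w v) \<and>
     (\<forall>x c. \<forall>v\<in>tangent_space \<A> x. \<forall>w\<in>tangent_space \<A> x.
        g x (c *\<^sub>T v) w = c * g x v w \<and> g x v (c *\<^sub>T w) = c * g x v w) \<and>
     (\<forall>X\<in>vector_fields \<A>. \<forall>Y\<in>vector_fields \<A>. smooth_fun \<A> (app02 g X Y))"

definition pseudo_Riemannian_metric ::
  "('a, 'e::euclidean_space) chart set \<Rightarrow> 'a tensor02 \<Rightarrow> bool" where
  "pseudo_Riemannian_metric \<A> g \<longleftrightarrow> tensor_field02 \<A> g \<and>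
     (\<forall>x. \<forall>v\<in>tangent_space \<A> x. \<forall>w\<in>tangent_space \<A> x. g x v w = g x w v) \<and>
     (\<forall>x. \<forall>v\<in>tangent_space \<A> x. (\<forall>w\<in>tangent_space \<A> x. g x v w = 0) \<longrightarrow> v = 0)"

definition metallic_pseudo_Riemannian_manifold ::
  "('a::{t2_space,second_countable_topology}, 'e::euclidean_space) chart set \<Rightarrow>
   'a tensor11 \<Rightarrow> 'a tensor02 \<Rightarrow> real \<Rightarrow> real \<Rightarrow> bool" where
  "metallic_pseudo_Riemannian_manifold \<A> J g p q \<longleftrightarrow>
     smooth_manifold \<A> \<and> pseudo_Riemannian_metric \<A> g \<and> tensor_field11 \<A> J \<and>
     (\<forall>X\<in>vector_fields \<A>. \<forall>Y\<in>vector_fields \<A>. app02 g (app11 J X) Y = app02 g X (app11 J Y)) \<and>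
     (\<forall>x. \<forall>v\<in>tangent_space \<A> x. J x (J x v) = p *\<^sub>T J x v + q *\<^sub>T v)"

section \<open>Linear connections\<close>

type_synonym 'a connection = "'a field \<Rightarrow> 'a field \<Rightarrow> 'a field"

definition linear_connection ::
  "('a, 'e::euclidean_space) chart set \<Rightarrow> 'a connection \<Rightarrow> bool" where
  "linear_connection \<A> D \<longleftrightarrow>
     (\<forall>X\<in>vector_fields \<A>. \<forall>Y\<in>vector_fields \<A>. D X Y \<in> vector_fields \<A>) \<and>
     (\<forall>X\<in>vector_fields \<A>. \<forall>Y\<in>vector_fields \<A>. \<forall>Z\<in>vector_fields \<A>.
        D (X + Y) Z = D X Z + D Y Z \<and> D X (Y + Z) = D X Y + D X Z) \<and>
     (\<forall>f. \<forall>X\<in>vector_fields \<A>. \<forall>Y\<in>vector_fields \<A>. smooth_fun \<A> f \<longrightarrow>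
        D (f *\<^sub>F X) Y = f *\<^sub>F D X Y) \<and>
     (\<forall>c. \<forall>X\<in>vector_fields \<A>. \<forall>Y\<in>vector_fields \<A>. D X (c *\<^sub>R\<^sub>F Y) = c *\<^sub>R\<^sub>F D X Y) \<and>
     (\<forall>f. \<forall>X\<in>vector_fields \<A>. \<forall>Y\<in>vector_fields \<A>. smooth_fun \<A> f \<longrightarrow>
        D X (f *\<^sub>F Y) = deriv_along X f *\<^sub>F Y + f *\<^sub>F D X Y)"

text \<open>\<open>covd11 D J X Y\<close> is $(D_X J)Y$ and \<open>covd02 D g X Y Z\<close> is $(D_X g)(Y,Z)$.\<close>

definition covd11 :: "'a connection \<Rightarrow> 'a tensor11 \<Rightarrow> 'a field \<Rightarrow> 'a field \<Rightarrow> 'a field" where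
  "covd11 D J X Y = D X (app11 J Y) - app11 J (D X Y)"

definition covd02 ::
  "'a connection \<Rightarrow> 'a tensor02 \<Rightarrow> 'a field \<Rightarrow> 'a field \<Rightarrow> 'a field \<Rightarrow> 'a \<Rightarrow> real" where
  "covd02 D g X Y Z = deriv_along X (app02 g Y Z) - app02 g (D X Y) Z - app02 g Y (D X Z)"

definition parallel11 ::
  "('a, 'e::euclidean_space) chart set \<Rightarrow> 'a connection \<Rightarrow> 'a tensor11 \<Rightarrow> bool" where
  "parallel11 \<A> D J \<longleftrightarrow> (\<forall>X\<in>vector_fields \<A>. \<forall>Y\<in>vector_fields \<A>. covd11 D J X Y = 0)"

definition parallel02 ::
  "('a, 'e::euclidean_space) chart set \<Rightarrow> 'a connection \<Rightarrow> 'a tensor02 \<Rightarrow> bool" where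
  "parallel02 \<A> D g \<longleftrightarrow>
     (\<forall>X\<in>vector_fields \<A>. \<forall>Y\<in>vector_fields \<A>. \<forall>Z\<in>vector_fields \<A>. covd02 D g X Y Z = 0)"

definition Levi_Civita_connection ::
  "('a, 'e::euclidean_space) chart set \<Rightarrow> 'a tensor02 \<Rightarrow> 'a connection \<Rightarrow> bool" where
  "Levi_Civita_connection \<A> g nabla \<longleftrightarrow> linear_connection \<A> nabla \<and>
     (\<forall>X\<in>vector_fields \<A>. \<forall>Y\<in>vector_fields \<A>. nabla X Y - nabla Y X = lie_bracket X Y) \<and>
     parallel02 \<A> nabla g"

end

theory Submission
  imports Defs
begin

text \<open>
  Write $N = \nabla_X J$ for a fixed $X$. Differentiating $J^2 = pJ + qI$ gives
  $NJ + JN = pN$, and differentiating the $g$-symmetry of $J$ shows that $N$ is $g$-symmetric.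
  With $\Delta = p^2 + 4q$ and $A = \frac{1}{\Delta}(2JN - pN)$, so that $D_X = \nabla_X + A$,
  the first relation yields $AJ - JA = -N$, which is $D_X J = 0$; both relations together make
  $A$ skew for $g$, which is $D_X g = 0$.
\<close>

section \<open>Smooth functions\<close>

text \<open>Differentiability gives continuity at the bottom level, and the induction then descends
  through the directional derivatives. The product rule needs this, because it multiplies
  derivatives by the undifferentiated factors, which are one class better than the induction
  hypothesis asks.\<close>

lemma Ck_on_SucD: "Ck_on (Suc k) S f \<Longrightarrow> Ck_on k S f"
proof (induction k arbitrary: f)
  case 0
  then show ?case
    by (auto simp: continuous_on_eq_continuous_at differentiable_imp_continuous_within
        intro!: continuous_at_imp_continuous_on)
next
  case (Suc k)
  then show ?case by (metis Ck_on.simps(2))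
qed

text \<open>Openness of \<open>S\<close> makes the derivative at a point of \<open>S\<close> depend
  only on the values in \<open>S\<close>. The sum and product formulas for
  \<open>frechet_derivative\<close> are available only at points of \<open>S\<close>, and this lemma
  lets them replace the derivative there.\<close>

lemma Ck_on_cong:
  assumes "open S" and "\<And>x. x \<in> S \<Longrightarrow> f x = h x" and "Ck_on k S f"
  shows "Ck_on k S h"
  using assms(2,3)
proof (induction k arbitrary: f h)
  case 0
  then show ?case using continuous_on_cong by fastforce
next
  case (Suc k)
  have diff: "(h has_derivative frechet_derivative f (at x)) (at x)" if "x \<in> S" for x
    using Suc.prems that \<open>open S\<close>
    by (auto intro: has_derivative_transform_within_open simp: frechet_derivative_works)
  then have "frechet_derivative f (at x) = frechet_derivative h (at x)" if "x \<in> S" for x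
    using frechet_derivative_at that by blast
  then have eq: "frechet_derivative f (at x) v = frechet_derivative h (at x) v" if "x \<in> S" for x v
    using that by simp
  have "Ck_on k S (\<lambda>x. frechet_derivative f (at x) v)" for v
    using Suc.prems(2) by simp
  from Suc.IH[OF eq this] have "Ck_on k S (\<lambda>x. frechet_derivative h (at x) v)" for v .
  moreover have "h differentiable (at x)" if "x \<in> S" for x
    using diff[OF that] by (rule differentiableI)
  ultimately show ?case by simp
qed

lemma Ck_on_const: "Ck_on k S (\<lambda>_. c)"
  by (induction k arbitrary: c) auto

lemma Ck_on_add:
  assumes "open S" "Ck_on k S f" "Ck_on k S h"
  shows "Ck_on k S (\<lambda>x. f x + h x)"
  using assms(2,3)
proof (induction k arbitrary: f h)
  case 0
  then show ?case by (auto intro: continuous_on_add)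
next
  case (Suc k)
  have deriv: "frechet_derivative (\<lambda>x. f x + h x) (at x) v =
      frechet_derivative f (at x) v + frechet_derivative h (at x) v"
    if "x \<in> S" for x v
  proof -
    have "((\<lambda>x. f x + h x) has_derivative
        (\<lambda>v. frechet_derivative f (at x) v + frechet_derivative h (at x) v)) (at x)"
      using Suc.prems that by (intro has_derivative_add) (auto simp: frechet_derivative_works)
    then show ?thesis using frechet_derivative_at by (metis (no_types, lifting))
  qed
  have "Ck_on k S (\<lambda>x. frechet_derivative (\<lambda>x. f x + h x) (at x) v)" for v
    by (rule Ck_on_cong[OF \<open>open S\<close> deriv[symmetric] Suc.IH]) (use Suc.prems in auto)
  with Suc.prems show ?case by auto
qed

lemma Ck_on_mult:
  fixes f h :: "'e::euclidean_space \<Rightarrow> real"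
  assumes "open S" "Ck_on k S f" "Ck_on k S h"
  shows "Ck_on k S (\<lambda>x. f x * h x)"
  using assms(2,3)
proof (induction k arbitrary: f h)
  case 0
  then show ?case by (simp add: continuous_on_mult)
next
  case (Suc k)
  have deriv: "frechet_derivative (\<lambda>x. f x * h x) (at x) v =
      f x * frechet_derivative h (at x) v + frechet_derivative f (at x) v * h x"
    if "x \<in> S" for x v
  proof -
    have "((\<lambda>x. f x * h x) has_derivative
        (\<lambda>v. f x * frechet_derivative h (at x) v + frechet_derivative f (at x) v * h x)) (at x)"
      using Suc.prems that by (intro has_derivative_mult) (auto simp: frechet_derivative_works)
    then show ?thesis using frechet_derivative_at by (metis (no_types, lifting))
  qed
  have "Ck_on k S (\<lambda>x. frechet_derivative (\<lambda>x. f x * h x) (at x) v)" for v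
  \<comment> \<open>Each summand of the product rule is a product of one factor of class
    \<open>Suc k\<close>, lowered to class \<open>k\<close>, and one derivative of class
    \<open>k\<close>, so the induction hypothesis covers both.\<close>
  proof (rule Ck_on_cong[OF \<open>open S\<close> deriv[symmetric] Ck_on_add[OF \<open>open S\<close> Suc.IH Suc.IH]])
    show "Ck_on k S f" "Ck_on k S h"
      using Suc.prems by (blast intro: Ck_on_SucD)+
  qed (use Suc.prems in auto)
  with Suc.prems show ?case by auto
qed

lemma smooth_fun_const: "smooth_fun \<A> (\<lambda>_. c)"
  by (auto simp: smooth_fun_def smooth_on_def comp_def Ck_on_const)

lemma smooth_fun_add:
  assumes "smooth_manifold \<A>" "smooth_fun \<A> f" "smooth_fun \<A> h"
  shows "smooth_fun \<A> (f + h)"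
proof -
  have "Ck_on k (\<phi> ` U) ((f + h) \<circ> inv_into U \<phi>)" if "(U, \<phi>) \<in> \<A>" for U \<phi> k
  proof -
    have "open (\<phi> ` U)" "Ck_on k (\<phi> ` U) (f \<circ> inv_into U \<phi>)" "Ck_on k (\<phi> ` U) (h \<circ> inv_into U \<phi>)"
      using assms that unfolding smooth_fun_def smooth_manifold_def smooth_on_def by blast+
    from Ck_on_add[OF this] show ?thesis by (simp add: comp_def)
  qed
  then show ?thesis by (auto simp: smooth_fun_def smooth_on_def)
qed

lemma smooth_fun_mult:
  assumes "smooth_manifold \<A>" "smooth_fun \<A> f" "smooth_fun \<A> h"
  shows "smooth_fun \<A> (f * h)"
proof -
  have "Ck_on k (\<phi> ` U) ((f * h) \<circ> inv_into U \<phi>)" if "(U, \<phi>) \<in> \<A>" for U \<phi> k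
  proof -
    have "open (\<phi> ` U)" "Ck_on k (\<phi> ` U) (f \<circ> inv_into U \<phi>)" "Ck_on k (\<phi> ` U) (h \<circ> inv_into U \<phi>)"
      using assms that unfolding smooth_fun_def smooth_manifold_def smooth_on_def by blast+
    from Ck_on_mult[OF this] show ?thesis by (simp add: comp_def)
  qed
  then show ?thesis by (auto simp: smooth_fun_def smooth_on_def)
qed

section \<open>The module of vector fields\<close>

lemma smult_field_apply: "(f *\<^sub>F X) x h = f x * X x h"
  by (simp add: smult_field_def smult_tangent_def)

lemma tangent_space_add:
  "v \<in> tangent_space \<A> x \<Longrightarrow> w \<in> tangent_space \<A> x \<Longrightarrow> v + w \<in> tangent_space \<A> x"
  unfolding tangent_space_def by (simp add: algebra_simps)

lemma tangent_space_smult: "v \<in> tangent_space \<A> x \<Longrightarrow> c *\<^sub>T v \<in> tangent_space \<A> x"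
  unfolding tangent_space_def by (simp add: smult_tangent_def algebra_simps)

lemma vector_fieldsD: "X \<in> vector_fields \<A> \<Longrightarrow> X x \<in> tangent_space \<A> x"
  by (simp add: vector_fields_def)

lemma vector_fields_add:
  assumes "smooth_manifold \<A>" "X \<in> vector_fields \<A>" "Y \<in> vector_fields \<A>"
  shows "X + Y \<in> vector_fields \<A>"
proof -
  have "deriv_along (X + Y) f = deriv_along X f + deriv_along Y f" for f
    by (auto simp: deriv_along_def)
  with assms show ?thesis
    by (auto simp: vector_fields_def tangent_space_add smooth_fun_add)
qed

lemma vector_fields_smult:
  assumes "smooth_manifold \<A>" "smooth_fun \<A> f" "X \<in> vector_fields \<A>"
  shows "f *\<^sub>F X \<in> vector_fields \<A>"
proof -
  have "deriv_along (f *\<^sub>F X) h = f * deriv_along X h" for h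
    by (auto simp: deriv_along_def smult_field_apply)
  with assms show ?thesis
    by (auto simp: vector_fields_def smult_field_def tangent_space_smult smooth_fun_mult)
qed

text \<open>Reduces differences to sums and multiples, so that closure and linearity for subtraction
  follow from the two module operations.\<close>

lemma field_diff_eq: "X - Y = X + (-1) *\<^sub>R\<^sub>F Y"
  by (auto simp: smult_field_apply fun_eq_iff)

lemma vector_fields_diff:
  assumes "smooth_manifold \<A>" "X \<in> vector_fields \<A>" "Y \<in> vector_fields \<A>"
  shows "X - Y \<in> vector_fields \<A>"
  unfolding field_diff_eq
  by (intro vector_fields_add vector_fields_smult smooth_fun_const assms)

lemma app11_add:
  assumes "tensor_field11 \<A> J" "X \<in> vector_fields \<A>" "Y \<in> vector_fields \<A>"
  shows "app11 J (X + Y) = app11 J X + app11 J Y"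
  using assms by (auto simp: app11_def tensor_field11_def vector_fieldsD fun_eq_iff)

lemma app11_smult:
  assumes "tensor_field11 \<A> J" "X \<in> vector_fields \<A>"
  shows "app11 J (f *\<^sub>F X) = f *\<^sub>F app11 J X"
  using assms by (auto simp: app11_def tensor_field11_def vector_fieldsD smult_field_def)

lemma app11_diff:
  assumes "smooth_manifold \<A>" "tensor_field11 \<A> J" "X \<in> vector_fields \<A>" "Y \<in> vector_fields \<A>"
  shows "app11 J (X - Y) = app11 J X - app11 J Y"
  unfolding field_diff_eq using assms
  by (simp add: app11_add app11_smult vector_fields_smult smooth_fun_const)

lemma app11_vector_fields:
  "tensor_field11 \<A> J \<Longrightarrow> X \<in> vector_fields \<A> \<Longrightarrow> app11 J X \<in> vector_fields \<A>"
  by (simp add: tensor_field11_def)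

lemma app02_add:
  assumes "tensor_field02 \<A> g" "X \<in> vector_fields \<A>" "Y \<in> vector_fields \<A>" "Z \<in> vector_fields \<A>"
  shows "app02 g (X + Y) Z = app02 g X Z + app02 g Y Z"
    and "app02 g Z (X + Y) = app02 g Z X + app02 g Z Y"
  using assms by (auto simp: app02_def tensor_field02_def vector_fieldsD fun_eq_iff)

lemma app02_smult:
  assumes "tensor_field02 \<A> g" "X \<in> vector_fields \<A>" "Z \<in> vector_fields \<A>"
  shows "app02 g (f *\<^sub>F X) Z = f * app02 g X Z"
    and "app02 g Z (f *\<^sub>F X) = f * app02 g Z X"
  using assms by (auto simp: app02_def tensor_field02_def vector_fieldsD smult_field_def fun_eq_iff)

lemma app02_diff:
  assumes "smooth_manifold \<A>" "tensor_field02 \<A> g"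
    "X \<in> vector_fields \<A>" "Y \<in> vector_fields \<A>" "Z \<in> vector_fields \<A>"
  shows "app02 g (X - Y) Z = app02 g X Z - app02 g Y Z"
    and "app02 g Z (X - Y) = app02 g Z X - app02 g Z Y"
  unfolding field_diff_eq using assms
  by (auto simp: app02_add[OF assms(2)] app02_smult[OF assms(2)] vector_fields_smult
      smooth_fun_const fun_eq_iff)

section \<open>Covariant derivatives\<close>

context
  fixes \<A> :: "('a::{t2_space,second_countable_topology}, 'e::euclidean_space) chart set"
    and J :: "'a tensor11" and nabla :: "'a connection"
  assumes mfd: "smooth_manifold \<A>" and J: "tensor_field11 \<A> J"
    and conn: "linear_connection \<A> nabla"
begin

text \<open>Collected as simplification rules that discharge the membership conditions of the
  linearity rules below.\<close>

private lemma closed: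
  "X \<in> vector_fields \<A> \<Longrightarrow> Y \<in> vector_fields \<A> \<Longrightarrow> nabla X Y \<in> vector_fields \<A>"
  "X \<in> vector_fields \<A> \<Longrightarrow> app11 J X \<in> vector_fields \<A>"
  "X \<in> vector_fields \<A> \<Longrightarrow> Y \<in> vector_fields \<A> \<Longrightarrow> X + Y \<in> vector_fields \<A>"
  "X \<in> vector_fields \<A> \<Longrightarrow> Y \<in> vector_fields \<A> \<Longrightarrow> X - Y \<in> vector_fields \<A>"
  "smooth_fun \<A> f \<Longrightarrow> X \<in> vector_fields \<A> \<Longrightarrow> f *\<^sub>F X \<in> vector_fields \<A>"
  using conn J mfd
  by (auto simp: linear_connection_def app11_vector_fields vector_fields_add vector_fields_diff
      vector_fields_smult)

private lemma nabla_rules: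
  assumes "X \<in> vector_fields \<A>" "Y \<in> vector_fields \<A>"
  shows "Z \<in> vector_fields \<A> \<Longrightarrow> nabla (X + Y) Z = nabla X Z + nabla Y Z"
    and "Z \<in> vector_fields \<A> \<Longrightarrow> nabla X (Y + Z) = nabla X Y + nabla X Z"
    and "smooth_fun \<A> f \<Longrightarrow> nabla (f *\<^sub>F X) Y = f *\<^sub>F nabla X Y"
    and "nabla X (c *\<^sub>R\<^sub>F Y) = c *\<^sub>R\<^sub>F nabla X Y"
    and "smooth_fun \<A> f \<Longrightarrow> nabla X (f *\<^sub>F Y) = deriv_along X f *\<^sub>F Y + f *\<^sub>F nabla X Y"
  using conn assms by (auto simp: linear_connection_def)

private lemmas J_rules = app11_add[OF J] app11_diff[OF mfd J] app11_smult[OF J]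

private lemma deriv_along_smooth:
  "X \<in> vector_fields \<A> \<Longrightarrow> smooth_fun \<A> f \<Longrightarrow> smooth_fun \<A> (deriv_along X f)"
  by (simp add: vector_fields_def)

lemma covd11_vector_fields:
  "X \<in> vector_fields \<A> \<Longrightarrow> Y \<in> vector_fields \<A> \<Longrightarrow> covd11 nabla J X Y \<in> vector_fields \<A>"
  by (simp add: covd11_def closed)

lemma covd11_add:
  assumes "X \<in> vector_fields \<A>" "Y \<in> vector_fields \<A>" "Z \<in> vector_fields \<A>"
  shows "covd11 nabla J (X + Y) Z = covd11 nabla J X Z + covd11 nabla J Y Z"
    and "covd11 nabla J X (Y + Z) = covd11 nabla J X Y + covd11 nabla J X Z"
  using assms by (simp_all add: covd11_def nabla_rules J_rules closed algebra_simps)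

text \<open>Tensoriality in the second argument: the Leibniz rule for
  \<open>nabla X (f *\<^sub>F app11 J Y)\<close> and \<open>J\<close> applied to the Leibniz rule
  for \<open>nabla X (f *\<^sub>F Y)\<close> both produce the term (Xf) JY, and the two
  cancel.\<close>

lemma covd11_smult:
  assumes "X \<in> vector_fields \<A>" "Y \<in> vector_fields \<A>" "smooth_fun \<A> f"
  shows "covd11 nabla J (f *\<^sub>F X) Y = f *\<^sub>F covd11 nabla J X Y"
    and "covd11 nabla J X (f *\<^sub>F Y) = f *\<^sub>F covd11 nabla J X Y"
  using assms
  by (auto simp: covd11_def nabla_rules J_rules closed deriv_along_smooth smult_field_apply fun_eq_iff
      algebra_simps)

text \<open>This is the relation NJ = pN - JN. Applying J^2 = pJ + qI to Y before differentiating,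
  and to \<open>nabla X Y\<close> afterwards, gives two expansions whose q-terms agree.\<close>

lemma covd11_metallic:
  assumes metallic: "\<forall>x. \<forall>v\<in>tangent_space \<A> x. J x (J x v) = p *\<^sub>T J x v + q *\<^sub>T v"
    and X: "X \<in> vector_fields \<A>" and Y: "Y \<in> vector_fields \<A>"
  shows "covd11 nabla J X (app11 J Y) = p *\<^sub>R\<^sub>F covd11 nabla J X Y - app11 J (covd11 nabla J X Y)"
proof -
  have sq: "app11 J (app11 J Z) = p *\<^sub>R\<^sub>F app11 J Z + q *\<^sub>R\<^sub>F Z" if "Z \<in> vector_fields \<A>" for Z
    using metallic vector_fieldsD[OF that] by (auto simp: app11_def smult_field_apply smult_tangent_def fun_eq_iff)
  show ?thesis
    using X Y
    by (auto simp: covd11_def sq nabla_rules J_rules closed smooth_fun_const smult_field_apply fun_eq_iff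
        algebra_simps)
qed

text \<open>Differentiate g(JY, Z) = g(Y, JZ) along X using that \<open>nabla\<close> is metric.
  Symmetry of J moves it across g in the terms where it is not differentiated, and these account for
  the J-terms of \<open>covd11\<close>.\<close>

lemma covd11_symmetric:
  assumes g: "tensor_field02 \<A> g" and par: "parallel02 \<A> nabla g"
    and symm: "\<forall>X\<in>vector_fields \<A>. \<forall>Y\<in>vector_fields \<A>.
      app02 g (app11 J X) Y = app02 g X (app11 J Y)"
    and XYZ: "X \<in> vector_fields \<A>" "Y \<in> vector_fields \<A>" "Z \<in> vector_fields \<A>"
  shows "app02 g (covd11 nabla J X Y) Z = app02 g Y (covd11 nabla J X Z)"
proof -
  have product_rule: "deriv_along X (app02 g V W) = app02 g (nabla X V) W + app02 g V (nabla X W)"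
    if "V \<in> vector_fields \<A>" "W \<in> vector_fields \<A>" for V W
    using par that XYZ(1) unfolding parallel02_def covd02_def
    by (simp add: diff_diff_eq)
  \<comment> \<open>Both sides are X(g(JY, Z)), the right one after rewriting the function as g(Y,
    JZ).\<close>
  have "app02 g (nabla X (app11 J Y)) Z + app02 g (app11 J Y) (nabla X Z) =
      app02 g (nabla X Y) (app11 J Z) + app02 g Y (nabla X (app11 J Z))"
    using product_rule[of "app11 J Y" Z] product_rule[of Y "app11 J Z"] symm XYZ closed
    by simp
  then show ?thesis
    using XYZ
    by (simp add: covd11_def app02_diff[OF mfd g] closed symm algebra_simps)
qed

section \<open>Connections nabla + A with A = aJN - bN, for constants a and b still
  undetermined\<close>

context
  fixes D :: "'a connection" and a b :: real
  assumes D: "\<And>X Y. X \<in> vector_fields \<A> \<Longrightarrow> Y \<in> vector_fields \<A> \<Longrightarrow>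
    D X Y = nabla X Y + a *\<^sub>R\<^sub>F app11 J (covd11 nabla J X Y) - b *\<^sub>R\<^sub>F covd11 nabla J X Y"
begin

text \<open>The correction A is bilinear over the smooth functions by \<open>covd11_add\<close>,
  \<open>covd11_smult\<close> and the linearity of J, so the Leibniz term of D is exactly that of
  \<open>nabla\<close>.\<close>

lemma linear_connection_perturbed: "linear_connection \<A> D"
  unfolding linear_connection_def
  by (auto simp: D closed covd11_vector_fields smooth_fun_const)
    (auto simp: nabla_rules covd11_add covd11_smult J_rules covd11_vector_fields smooth_fun_const
      smult_field_apply fun_eq_iff algebra_simps)

text \<open>By NJ = pN - JN and J^2 = pJ + qI, the derivative of J under D is a combination of N and
  JN. The two equations in \<open>coeff\<close> say that both of its coefficients vanish.\<close>

lemma parallel11_perturbed: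
  assumes metallic: "\<forall>x. \<forall>v\<in>tangent_space \<A> x. J x (J x v) = p *\<^sub>T J x v + q *\<^sub>T v"
    and coeff: "b * p + 2 * a * q = 1" "a * p = 2 * b"
  shows "parallel11 \<A> D J"
  unfolding parallel11_def
proof (intro ballI)
  fix X Y assume XY: "X \<in> vector_fields \<A>" "Y \<in> vector_fields \<A>"
  define N where "N = covd11 nabla J X Y"
  have N: "N \<in> vector_fields \<A>" using XY by (simp add: N_def covd11_vector_fields)
  have JJN: "app11 J (app11 J N) = p *\<^sub>R\<^sub>F app11 J N + q *\<^sub>R\<^sub>F N"
    using metallic vector_fieldsD[OF N] by (auto simp: app11_def smult_field_apply smult_tangent_def fun_eq_iff)
  \<comment> \<open>The bracketed terms are the correction of D at (X, JY), with N(JY) rewritten by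
    \<open>covd11_metallic\<close>; the last two are the correction at (X, Y) after J is applied and
    the result subtracted.\<close>
  have "covd11 D J X Y = N
      + a *\<^sub>R\<^sub>F app11 J (p *\<^sub>R\<^sub>F N - app11 J N) - b *\<^sub>R\<^sub>F (p *\<^sub>R\<^sub>F N - app11 J N)
      - a *\<^sub>R\<^sub>F app11 J (app11 J N) + b *\<^sub>R\<^sub>F app11 J N"
    using XY N unfolding covd11_def[of D] D[OF XY] D[OF XY(1) closed(2)[OF XY(2)]]
      covd11_metallic[OF metallic XY, folded N_def] N_def[symmetric]
    by (simp add: J_rules closed smooth_fun_const) (simp add: N_def covd11_def algebra_simps)
  also have "\<dots> = (1 - b * p - 2 * a * q) *\<^sub>R\<^sub>F N + (2 * b - a * p) *\<^sub>R\<^sub>F app11 J N"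
    using N by (auto simp: J_rules JJN closed smooth_fun_const smult_field_apply fun_eq_iff algebra_simps)
  also have "\<dots> = 0" using coeff by (auto simp: smult_field_apply fun_eq_iff)
  finally show "covd11 D J X Y = 0" .
qed

text \<open>As \<open>nabla\<close> is metric, the claim is that A is skew for g. The symmetric part
  of A comes out as a multiple of N by ap - 2b, which is zero.\<close>

lemma parallel02_perturbed:
  assumes metallic: "\<forall>x. \<forall>v\<in>tangent_space \<A> x. J x (J x v) = p *\<^sub>T J x v + q *\<^sub>T v"
    and g: "tensor_field02 \<A> g" and par: "parallel02 \<A> nabla g"
    and symm: "\<forall>X\<in>vector_fields \<A>. \<forall>Y\<in>vector_fields \<A>.
      app02 g (app11 J X) Y = app02 g X (app11 J Y)"
    and coeff: "a * p = 2 * b"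
  shows "parallel02 \<A> D g"
  unfolding parallel02_def
proof (intro ballI)
  fix X Y Z assume XYZ: "X \<in> vector_fields \<A>" "Y \<in> vector_fields \<A>" "Z \<in> vector_fields \<A>"
  define N where "N = covd11 nabla J X"
  have N: "N V \<in> vector_fields \<A>" if "V \<in> vector_fields \<A>" for V
    using XYZ that by (simp add: N_def covd11_vector_fields)
  note g_rules = app02_add[OF g] app02_diff[OF mfd g] app02_smult[OF g]
  have N_symm: "app02 g (N V) W = app02 g V (N W)"
    if "V \<in> vector_fields \<A>" "W \<in> vector_fields \<A>" for V W
    unfolding N_def using covd11_symmetric[OF g par symm XYZ(1) that] by blast
  \<comment> \<open>J and N are both g-symmetric, so the g-adjoint of JN is NJ, that is pN -
    JN.\<close>
  have "app02 g (app11 J (N Y)) Z = app02 g Y (N (app11 J Z))"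
    using XYZ by (simp add: symm N N_symm closed)
  also have "\<dots> = (\<lambda>_. p) * app02 g Y (N Z) - app02 g Y (app11 J (N Z))"
    using XYZ unfolding N_def covd11_metallic[OF metallic XYZ(1,3)]
    by (simp add: g_rules closed smooth_fun_const covd11_vector_fields)
  finally have JN_symm: "app02 g (app11 J (N Y)) Z = \<dots>" .
  have "covd02 D g X Y Z = covd02 nabla g X Y Z
      - ((\<lambda>_. a) * app02 g (app11 J (N Y)) Z - (\<lambda>_. b) * app02 g (N Y) Z)
      - ((\<lambda>_. a) * app02 g Y (app11 J (N Z)) - (\<lambda>_. b) * app02 g Y (N Z))"
    using XYZ N unfolding covd02_def D[OF XYZ(1,2)] D[OF XYZ(1,3)] N_def[symmetric]
    by (simp add: g_rules closed smooth_fun_const algebra_simps)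
  \<comment> \<open>The terms g(Y, JNZ) cancel, since JN enters once directly and once with opposite
    sign through its adjoint.\<close>
  also have "\<dots> = (\<lambda>_. 2 * b - a * p) * app02 g Y (N Z)"
    using par XYZ unfolding JN_symm N_symm[OF XYZ(2,3)]
    by (auto simp: parallel02_def fun_eq_iff algebra_simps)
  also have "\<dots> = 0" using coeff by (auto simp: fun_eq_iff)
  finally show "covd02 D g X Y Z = 0" .
qed

end

end

theorem theorem3p1:
  fixes \<A> :: "('a::{t2_space,second_countable_topology}, 'e::euclidean_space) chart set"
    and J :: "'a tensor11" and g :: "'a tensor02"
    and nabla D :: "'a connection" and p q :: real
  assumes "metallic_pseudo_Riemannian_manifold \<A> J g p q"
    and "p\<^sup>2 + 4 * q \<noteq> 0"
    and "Levi_Civita_connection \<A> g nabla"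
    and "\<And>X Y. X \<in> vector_fields \<A> \<Longrightarrow> Y \<in> vector_fields \<A> \<Longrightarrow>
           D X Y = nabla X Y + (2 / (p\<^sup>2 + 4 * q)) *\<^sub>R\<^sub>F app11 J (covd11 nabla J X Y)
                         - (p / (p\<^sup>2 + 4 * q)) *\<^sub>R\<^sub>F covd11 nabla J X Y"
  shows "linear_connection \<A> D \<and> parallel11 \<A> D J \<and> parallel02 \<A> D g"
proof -
  have mfd: "smooth_manifold \<A>" and J: "tensor_field11 \<A> J" and g: "tensor_field02 \<A> g"
    and symm: "\<forall>X\<in>vector_fields \<A>. \<forall>Y\<in>vector_fields \<A>.
      app02 g (app11 J X) Y = app02 g X (app11 J Y)"
    and metallic: "\<forall>x. \<forall>v\<in>tangent_space \<A> x. J x (J x v) = p *\<^sub>T J x v + q *\<^sub>T v"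
    using assms(1)
    by (auto simp: metallic_pseudo_Riemannian_manifold_def pseudo_Riemannian_metric_def)
  have conn: "linear_connection \<A> nabla" and par: "parallel02 \<A> nabla g"
    using assms(3) by (auto simp: Levi_Civita_connection_def)
  \<comment> \<open>These values are forced: substituting b = ap/2 into bp + 2aq = 1 gives a(p^2 +
    4q) = 2, which is solvable because p^2 + 4q is nonzero.\<close>
  let ?a = "2 / (p\<^sup>2 + 4 * q)" and ?b = "p / (p\<^sup>2 + 4 * q)"
  have "?b * p + 2 * ?a * q = (p\<^sup>2 + 4 * q) / (p\<^sup>2 + 4 * q)"
    unfolding add_divide_distrib by (simp add: power2_eq_square)
  then have coeff: "?b * p + 2 * ?a * q = 1" "?a * p = 2 * ?b"
    using assms(2) by auto
  show ?thesis
    using linear_connection_perturbed[OF mfd J conn assms(4)]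
      parallel11_perturbed[OF mfd J conn assms(4) metallic coeff]
      parallel02_perturbed[OF mfd J conn assms(4) metallic g par symm coeff(2)]
    by blast
qed

end
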